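(* (1) Let $q\in(0,1)$ and define on $(0,+\infty)$ the function $$\Phi_q(x)=\frac{q^x-1}{\log q}\,\psi_q'(x)-q^x.$$ Then for all integers $n\geq 0$, the function $(-1)^n\Phi_q^{(n)}$ is completely monotonic on $(0,+\infty)$. (2) Let $q>1$. Then the function $$\phi_q(x)=\frac{q^x-1}{q^x\log q}\,\psi_q'(x)-1$$ is completely monotonic on $(0,+\infty)$.
   Context: $\psi_q=\Gamma_q'/\Gamma_q$ is the $q$-digamma function on $(0,+\infty)$, where $\Gamma_q$ is the $q$-gamma function: for $0<q<1$, $\Gamma_q(x)=(1-q)^{1-x}\prod_{k=0}^\infty\frac{1-q^{k+1}}{1-q^{k+x}}$, and for $q>1$, $\Gamma_q(x)=q^{(x-1)(x-2)/2}\,\Gamma_{1/q}(x)$. In particular, for $0<q<1$, $\psi_q'(x)=(\log q)^2\sum_{k=1}^\infty\frac{k\,q^{kx}}{1-q^k}$, and for $q>1$, $\psi_q'(x)=\log q+\psi_{1/q}'(x)$. A function $f$ is completely monotonic on an interval $I$ if it has derivatives of all orders on $I$ and $(-1)^n f^{(n)}(x)\geq 0$ for all $x\in I$ and all integers $n\geq 0$. *)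

theory Defs
  imports "HOL-Analysis.Analysis"
begin

text \<open>
  The functions below are total on the reals, but are only meaningful for \<open>q > 0\<close>, \<open>q \<noteq> 1\<close>
  and \<open>x > 0\<close>. There every factor of the infinite product is positive.
\<close>

definition q_Gamma_less_1 :: "real \<Rightarrow> real \<Rightarrow> real" where
  "q_Gamma_less_1 q x =
     (1 - q) powr (1 - x) * (\<Prod>k. (1 - q ^ (k + 1)) / (1 - q powr (real k + x)))"

definition q_Gamma :: "real \<Rightarrow> real \<Rightarrow> real" where
  "q_Gamma q x =
     (if q < 1 then q_Gamma_less_1 q x
      else q powr ((x - 1) * (x - 2) / 2) * q_Gamma_less_1 (1 / q) x)"

definition q_digamma :: "real \<Rightarrow> real \<Rightarrow> real" where
  "q_digamma q x = deriv (q_Gamma q) x / q_Gamma q x"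

text \<open>
  For open intervals \<open>I\<close> only: derivatives are two-sided. The differentiability clause is needed
  because \<^const>\<open>deriv\<close> is an unspecified value where the derivative does not exist.
\<close>

definition completely_monotonic_on :: "real set \<Rightarrow> (real \<Rightarrow> real) \<Rightarrow> bool" where
  "completely_monotonic_on I f \<longleftrightarrow>
     (\<forall>n. \<forall>x\<in>I. (deriv ^^ n) f differentiable (at x)) \<and>
     (\<forall>n. \<forall>x\<in>I. (-1) ^ n * (deriv ^^ n) f x \<ge> 0)"

definition Phi_fun :: "real \<Rightarrow> real \<Rightarrow> real" where
  "Phi_fun q x = (q powr x - 1) / ln q * deriv (q_digamma q) x - q powr x"

definition phi_fun :: "real \<Rightarrow> real \<Rightarrow> real" where
  "phi_fun q x = (q powr x - 1) / (q powr x * ln q) * deriv (q_digamma q) x - 1"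

end

theory Submission
  imports Defs
begin

text \<open>
  Put \<open>t = q powr x\<close>. For \<open>0 < q < 1\<close> the power series \<open>P t = (\<Sum>j\<ge>1. t ^ j / (j * (1 - q ^ j)))\<close>
  satisfies \<open>P t - P (q * t) = - ln (1 - t)\<close>, so the infinite product in \<open>\<Gamma>\<^sub>q\<close> telescopes to
  \<open>exp (P t - P q)\<close>. Differentiating termwise in \<open>x\<close>, \<open>\<Phi>\<^sub>q\<close> becomes a power series in \<open>t\<close> with
  coefficients \<open>b j - b (j - 1) - [j = 1]\<close>, where \<open>b j = - ln q * j / (1 - q ^ j)\<close>. These are
  nonnegative because \<open>j / (1 - q ^ j)\<close> increases with \<open>j\<close> and \<open>- ln q \<ge> 1 - q\<close>. As \<open>t ^ j\<close> is a
  decaying exponential in \<open>x\<close>, complete monotonicity follows. Finally \<open>\<phi>\<^sub>q = \<Phi>\<^bsub>1/q\<^esub>\<close> for \<open>q > 1\<close>.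
\<close>

section \<open>Complete monotonicity from an explicit sequence of derivatives\<close>

text \<open>As \<open>S\<close> is open, equality on \<open>S\<close> holds near each of its points,
  so each derivative passes from \<open>G n\<close> to the iterate of \<open>deriv\<close>.\<close>

lemma higher_deriv_unique:
  assumes S: "open S"
    and G: "\<And>n x. x \<in> S \<Longrightarrow> (G n has_real_derivative G (Suc n) x) (at x)"
    and eq: "\<And>x. x \<in> S \<Longrightarrow> f x = G 0 x"
  shows "x \<in> S \<Longrightarrow> (deriv ^^ n) f x = G n x"
proof (induction n arbitrary: x)
  case 0
  then show ?case using eq by simp
next
  case (Suc n)
  have "((deriv ^^ n) f has_real_derivative G (Suc n) x) (at x)"
    by (rule has_field_derivative_transform_within_open[OF G[OF Suc.prems] S Suc.prems])
      (simp add: Suc.IH)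
  then show ?case by (simp add: DERIV_imp_deriv)
qed

lemma completely_monotonic_onI:
  assumes S: "open S"
    and G: "\<And>n x. x \<in> S \<Longrightarrow> (G n has_real_derivative G (Suc n) x) (at x)"
    and eq: "\<And>x. x \<in> S \<Longrightarrow> f x = G 0 x"
    and nonneg: "\<And>n x. x \<in> S \<Longrightarrow> 0 \<le> (-1) ^ n * G n x"
  shows "completely_monotonic_on S f"
proof -
  note D = higher_deriv_unique[of S G f, OF S G eq]
  have "((deriv ^^ n) f has_real_derivative G (Suc n) x) (at x)" if "x \<in> S" for n x
    by (rule has_field_derivative_transform_within_open[OF G[OF that] S that]) (simp add: D)
  then have "(deriv ^^ n) f differentiable (at x)" if "x \<in> S" for n x
    using that real_differentiable_def by blast
  then show ?thesis
    using D nonneg unfolding completely_monotonic_on_def by simp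
qed

section \<open>Power series in \<open>q powr x\<close>\<close>

definition powr_series :: "real \<Rightarrow> (nat \<Rightarrow> real) \<Rightarrow> real \<Rightarrow> real" where
  "powr_series q a x = (\<Sum>j. a j * (q powr x) ^ j)"

definition disc_summable :: "(nat \<Rightarrow> real) \<Rightarrow> bool" where
  "disc_summable a \<longleftrightarrow> (\<forall>r. norm r < 1 \<longrightarrow> summable (\<lambda>j. a j * r ^ j))"

lemma disc_summable_bounded:
  assumes "\<And>j. \<bar>a j\<bar> \<le> C"
  shows "disc_summable a"
  unfolding disc_summable_def
proof (intro allI impI)
  fix r :: real assume r: "norm r < 1"
  have "summable (\<lambda>j. C * \<bar>r\<bar> ^ j)"
    using r by (intro summable_mult summable_geometric) simp
  then show "summable (\<lambda>j. a j * r ^ j)"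
    by (rule summable_comparison_test[OF _, rotated])
      (auto simp: abs_mult power_abs intro!: mult_right_mono assms)
qed

text \<open>Weighting by the index is the operator r * d/dr, which preserves convergence in the unit
  disc.\<close>

lemma index_weighted_sums:
  assumes "disc_summable a" "norm (r :: real) < 1"
  shows "(\<lambda>j. real j * a j * r ^ j) sums (r * (\<Sum>j. diffs a j * r ^ j))"
proof -
  have "summable (\<lambda>j. diffs a j * r ^ j)"
    using assms unfolding disc_summable_def by (intro termdiff_converges[where K = 1]) auto
  then have "(\<lambda>j. r * (real j * a j * r ^ (j - Suc 0))) sums (r * (\<Sum>j. diffs a j * r ^ j))"
    by (intro sums_mult diffs_equiv)
  moreover have "r * (real j * a j * r ^ (j - Suc 0)) = real j * a j * r ^ j" for j
    by (cases j) auto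
  ultimately show ?thesis by simp
qed

lemma disc_summable_index_mult:
  assumes "disc_summable a"
  shows "disc_summable (\<lambda>j. real j * c * a j)"
  unfolding disc_summable_def
proof (intro allI impI)
  fix r :: real assume "norm r < 1"
  from summable_mult[OF sums_summable[OF index_weighted_sums[OF assms this]], of c]
  show "summable (\<lambda>j. real j * c * a j * r ^ j)" by (simp add: mult_ac)
qed

lemma powr_lt_1:
  fixes q x :: real
  assumes "0 < q" "q < 1" "0 < x"
  shows "0 < q powr x" "q powr x < 1"
  using assms powr_less_mono'[of q 0 x] by auto

text \<open>For t = \<open>q powr x\<close>, d/dx is \<open>ln q\<close> * t * d/dt, which acts
  diagonally on the coefficients.\<close>

lemma DERIV_powr_series:
  assumes q: "0 < q" "q < 1" and x: "0 < x" and a: "disc_summable a"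
  shows "(powr_series q a has_real_derivative powr_series q (\<lambda>j. real j * ln q * a j) x) (at x)"
proof -
  let ?t = "q powr x"
  have t: "norm ?t < 1" using powr_lt_1[OF q x] by simp
  have "((\<lambda>z. \<Sum>j. a j * z ^ j) has_real_derivative (\<Sum>j. diffs a j * ?t ^ j)) (at ?t)"
    using a t unfolding disc_summable_def by (intro termdiffs_strong'[where K = 1]) auto
  moreover have "((\<lambda>x. q powr x) has_real_derivative ?t * ln q) (at x)"
    using q by (auto intro!: derivative_eq_intros)
  ultimately have D: "((\<lambda>x. \<Sum>j. a j * (q powr x) ^ j) has_real_derivative
      (\<Sum>j. diffs a j * ?t ^ j) * (?t * ln q)) (at x)"
    by (rule DERIV_chain2)
  have "(\<lambda>j. ln q * (real j * a j * ?t ^ j)) sums (ln q * (?t * (\<Sum>j. diffs a j * ?t ^ j)))"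
    by (intro sums_mult index_weighted_sums a t)
  then have "powr_series q (\<lambda>j. real j * ln q * a j) x = (\<Sum>j. diffs a j * ?t ^ j) * (?t * ln q)"
    unfolding powr_series_def by (subst sums_unique[symmetric]) (auto simp: mult_ac)
  then show ?thesis using D unfolding powr_series_def by simp
qed

lemma disc_summable_power_mult:
  assumes "disc_summable a"
  shows "disc_summable (\<lambda>j. (real j * c) ^ n * a j)"
proof (induction n)
  case (Suc n)
  from disc_summable_index_mult[OF Suc.IH, of c] show ?case by (simp add: mult_ac)
qed (use assms in simp)

lemma DERIV_powr_series_higher:
  assumes "0 < q" "q < 1" "0 < x" "disc_summable a"
  shows "(powr_series q (\<lambda>j. (real j * ln q) ^ n * a j) has_real_derivative
          powr_series q (\<lambda>j. (real j * ln q) ^ Suc n * a j) x) (at x)"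
  using DERIV_powr_series[OF assms(1-3) disc_summable_power_mult[OF assms(4)], of "ln q" n]
  by (simp add: mult.assoc)

text \<open>Since \<open>ln q\<close> is negative, the sign (-1)^n turns (j * ln q)^n into (j * (-
  ln q))^n, which is nonnegative.\<close>

lemma powr_series_sign:
  assumes q: "0 < q" "q < 1" and x: "0 < x" and a: "disc_summable a" and nn: "\<And>j. 0 \<le> a j"
  shows "0 \<le> (-1) ^ n * powr_series q (\<lambda>j. (real j * ln q) ^ n * a j) x"
proof -
  have s: "summable (\<lambda>j. (real j * ln q) ^ n * a j * (q powr x) ^ j)"
    using disc_summable_power_mult[OF a] powr_lt_1[OF q x] unfolding disc_summable_def by simp
  have "0 \<le> (\<Sum>j. (-1) ^ n * ((real j * ln q) ^ n * a j * (q powr x) ^ j))"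
  proof (intro suminf_nonneg summable_mult s)
    fix j
    have "0 \<le> (real j * (- ln q)) ^ n * a j * (q powr x) ^ j"
      using q nn by (intro mult_nonneg_nonneg zero_le_power) auto
    moreover have "(real j * (- ln q)) ^ n = (-1) ^ n * (real j * ln q) ^ n"
      by (simp flip: power_mult_distrib)
    ultimately show "0 \<le> (-1) ^ n * ((real j * ln q) ^ n * a j * (q powr x) ^ j)"
      by (simp add: mult.assoc)
  qed
  then show ?thesis unfolding powr_series_def by (simp add: suminf_mult[OF s])
qed

text \<open>Differentiating \<open>m\<close> times more gives order \<open>n + m\<close>, and the
  two signs combine to (-1)^(n + m). The case \<open>n = 0\<close> gives complete monotonicity of
  \<open>f\<close> itself.\<close>

lemma completely_monotonic_powr_series:
  assumes q: "0 < q" "q < 1" and a: "disc_summable a" "\<And>j. 0 \<le> a j"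
    and eq: "\<And>x. 0 < x \<Longrightarrow> f x = powr_series q a x"
  shows "completely_monotonic_on {0<..} (\<lambda>x. (-1) ^ n * (deriv ^^ n) f x)"
proof (rule completely_monotonic_onI)
  let ?G = "\<lambda>m. powr_series q (\<lambda>j. (real j * ln q) ^ m * a j)"
  show "open {0::real<..}" by simp
  show "((\<lambda>x. (-1) ^ n * ?G (n + m) x) has_real_derivative (-1) ^ n * ?G (n + Suc m) x) (at x)"
    if "x \<in> {0<..}" for m x
    using that DERIV_cmult[OF DERIV_powr_series_higher[OF q _ a(1)], of x "(-1) ^ n" "n + m"]
    by simp
  show "(-1) ^ n * (deriv ^^ n) f x = (-1) ^ n * ?G (n + 0) x" if "x \<in> {0<..}" for x
    using higher_deriv_unique[of "{0<..}" ?G f x n] DERIV_powr_series_higher[OF q _ a(1)] eq that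
    by simp
  show "0 \<le> (-1) ^ m * ((-1) ^ n * ?G (n + m) x)" if "x \<in> {0<..}" for m x
    using that powr_series_sign[OF q _ a, of x "n + m"] by (simp add: power_add mult_ac)
qed

section \<open>The q-gamma function as the exponential of a power series\<close>

text \<open>The coefficients of \<open>P\<close>. The constant term is \<open>1 / 0 = 0\<close>.\<close>

definition lnqp_coeff :: "real \<Rightarrow> nat \<Rightarrow> real" where
  "lnqp_coeff q j = 1 / (real j * (1 - q ^ j))"

text \<open>For j >= 1 the denominator is smallest at j = 1, where it is
  \<open>1 - q\<close>.\<close>

lemma disc_summable_lnqp_coeff:
  assumes "0 < q" "q < 1"
  shows "disc_summable (lnqp_coeff q)"
proof (rule disc_summable_bounded)
  fix j
  show "\<bar>lnqp_coeff q j\<bar> \<le> 1 / (1 - q)"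
  proof (cases j)
    case (Suc m)
    have "q ^ Suc m \<le> q" using assms by (simp add: mult_left_le power_le_one)
    then have "1 * (1 - q) \<le> real (Suc m) * (1 - q ^ Suc m)"
      using assms by (intro mult_mono) auto
    then have "1 - q \<le> real (Suc m) * (1 - q ^ Suc m)" by simp
    with assms have "1 / (real (Suc m) * (1 - q ^ Suc m)) \<le> 1 / (1 - q)"
      "0 < real (Suc m) * (1 - q ^ Suc m)"
      by (auto intro!: frac_le simp del: of_nat_Suc)
    then show ?thesis unfolding lnqp_coeff_def Suc by (simp del: of_nat_Suc power_Suc)
  qed (use assms in \<open>simp add: lnqp_coeff_def\<close>)
qed

text \<open>The factor 1 - q^j from t^j - (q * t)^j cancels the one in the coefficient and leaves
  the logarithmic series.\<close>

lemma lnqp_functional_equation: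
  assumes q: "0 < q" "q < 1" and t: "0 < t" "t < 1"
  shows "(\<Sum>j. lnqp_coeff q j * t ^ j) - (\<Sum>j. lnqp_coeff q j * (q * t) ^ j) = - ln (1 - t)"
proof -
  have qt: "norm (q * t) < 1" using q t mult_strict_mono[of q 1 t 1] by simp
  have s: "summable (\<lambda>j. lnqp_coeff q j * t ^ j)" "summable (\<lambda>j. lnqp_coeff q j * (q * t) ^ j)"
    using disc_summable_lnqp_coeff[OF q] t qt unfolding disc_summable_def by auto
  have "(\<lambda>j. - (t ^ j / real j)) sums ln (1 - t)"
    using ln_series'[of "- t"] t by simp
  then have "(\<lambda>j. t ^ j / real j) sums - ln (1 - t)"
    using sums_minus by fastforce
  moreover have "lnqp_coeff q j * t ^ j - lnqp_coeff q j * (q * t) ^ j = t ^ j / real j" for j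
  proof (cases j)
    case (Suc m)
    have "q ^ j < 1" using q Suc by (simp add: power_Suc_less_one del: power_Suc)
    then show ?thesis
      using Suc
      by (simp add: lnqp_coeff_def power_mult_distrib divide_simps del: of_nat_Suc power_Suc)
        (simp add: algebra_simps)
  qed (simp add: lnqp_coeff_def)
  ultimately show ?thesis
    by (simp add: suminf_diff[OF s] sums_iff)
qed

text \<open>The functional equation telescopes the finite product to exp (P (q^n * t) - P t), and P
  (q^n * t) tends to P 0 = 0 by continuity.\<close>

lemma q_Pochhammer_tendsto:
  assumes q: "0 < q" "q < 1" and t: "0 < t" "t < 1"
  shows "(\<lambda>n. \<Prod>k<n. 1 - q ^ k * t) \<longlonglongrightarrow> exp (- (\<Sum>j. lnqp_coeff q j * t ^ j))"
proof -
  define P where "P = (\<lambda>t. \<Sum>j. lnqp_coeff q j * t ^ j)"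
  have qt: "0 < q ^ k * t" "q ^ k * t < 1" for k
    using q t mult_left_le_one_le[of t "q ^ k"] power_le_one[of q k]
    by (simp, smt (verit) zero_le_power)
  have "(\<Prod>k<n. 1 - q ^ k * t) = exp (P (q ^ n * t) - P t)" for n
  proof (induction n)
    case (Suc n)
    have "P (q ^ n * t) - P (q ^ Suc n * t) = - ln (1 - q ^ n * t)"
      using lnqp_functional_equation[OF q qt[of n]] by (simp add: P_def mult_ac)
    then have "1 - q ^ n * t = exp (P (q ^ Suc n * t) - P (q ^ n * t))"
      using qt[of n] by (smt (verit) exp_ln)
    then show ?case using Suc by (simp flip: exp_add)
  qed simp
  moreover have "(\<lambda>n. P (q ^ n * t)) \<longlonglongrightarrow> P 0"
  proof (rule isCont_tendsto_compose[where g = P])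
    have "(P has_field_derivative (\<Sum>j. diffs (lnqp_coeff q) j * 0 ^ j)) (at 0)"
      using disc_summable_lnqp_coeff[OF q] unfolding disc_summable_def P_def
      by (intro termdiffs_strong'[where K = 1]) auto
    then show "isCont P 0" by (rule DERIV_isCont)
    show "(\<lambda>n. q ^ n * t) \<longlonglongrightarrow> 0"
      using q by (intro tendsto_mult_left_zero LIMSEQ_power_zero) auto
  qed
  moreover have "P 0 = 0" unfolding P_def powser_zero by (simp add: lnqp_coeff_def)
  ultimately show ?thesis
    by (auto intro!: tendsto_eq_intros simp: fun_cong[OF P_def, of t])
qed

lemma q_Gamma_less_1_eq:
  assumes q: "0 < q" "q < 1" and x: "0 < x"
  shows "q_Gamma_less_1 q x = (1 - q) powr (1 - x) *
    exp (powr_series q (lnqp_coeff q) x - powr_series q (lnqp_coeff q) 1)"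
proof -
  let ?P = "powr_series q (lnqp_coeff q)"
  let ?f = "\<lambda>k. (1 - q ^ (k + 1)) / (1 - q powr (real k + x))"
  have "(\<lambda>n. (\<Prod>k<n. 1 - q ^ k * q) / (\<Prod>k<n. 1 - q ^ k * q powr x)) \<longlonglongrightarrow> exp (- ?P 1) / exp (- ?P x)"
    using q_Pochhammer_tendsto[OF q q] q_Pochhammer_tendsto[OF q powr_lt_1[OF q x]] q
    unfolding powr_series_def by (intro tendsto_divide) auto
  moreover have "(\<Prod>k<n. 1 - q ^ k * q) / (\<Prod>k<n. 1 - q ^ k * q powr x) = (\<Prod>k<n. ?f k)" for n
    using q by (simp add: prod_dividef powr_add powr_realpow mult.commute)
  ultimately have "(\<lambda>n. \<Prod>k<n. ?f k) \<longlonglongrightarrow> exp (?P x - ?P 1)"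
    by (simp add: exp_diff exp_minus field_simps)
  \<comment> \<open>\<open>raw_has_prod\<close> uses products up to and including \<open>n\<close>
    and demands a nonzero limit, which an exponential is.\<close>
  then have "(\<lambda>n. \<Prod>k\<le>n. ?f k) \<longlonglongrightarrow> exp (?P x - ?P 1)"
    by (subst (asm) LIMSEQ_lessThan_iff_atMost)
  then have "?f has_prod exp (?P x - ?P 1)"
    unfolding has_prod_def raw_has_prod_def by simp
  then show ?thesis
    unfolding q_Gamma_less_1_def by (simp add: has_prod_unique[symmetric])
qed

section \<open>The derivative of the q-digamma function\<close>

text \<open>
  The extra parameter \<open>e\<close> covers both ranges of the base: it is \<open>0\<close> for base \<open>q < 1\<close> and \<open>ln (1 / q)\<close>
  for base \<open>1 / q > 1\<close>.
\<close>

lemma deriv_log_deriv_q_Gamma: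
  assumes q: "0 < q" "q < 1" and x: "0 < x"
    and \<Gamma>: "\<And>x. 0 < x \<Longrightarrow> g x = exp (e * ((x - 1) * (x - 2) / 2)) * q_Gamma_less_1 q x"
  shows "deriv (\<lambda>x. deriv g x / g x) x =
    e + powr_series q (\<lambda>j. (real j * ln q) ^ 2 * lnqp_coeff q j) x"
proof -
  let ?S = "{0::real<..}"
  define P where "P n = powr_series q (\<lambda>j. (real j * ln q) ^ n * lnqp_coeff q j)" for n
  have DP: "(P n has_real_derivative P (Suc n) y) (at y)" if "0 < y" for n y
    unfolding P_def by (rule DERIV_powr_series_higher[OF q that disc_summable_lnqp_coeff[OF q]])
  \<comment> \<open>\<open>h\<close> is the logarithm of \<open>g\<close> on the positive axis. In
    its second derivative the quadratic leaves \<open>e\<close> and the linear term leaves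
    nothing.\<close>
  define h where "h = (\<lambda>x. e * ((x - 1) * (x - 2) / 2) + (1 - x) * ln (1 - q) + P 0 x - P 0 1)"
  define h' where "h' = (\<lambda>x. e * ((2 * x - 3) / 2) - ln (1 - q) + P 1 x)"
  have g: "g y = exp (h y)" if "0 < y" for y
    using \<Gamma>[OF that] q_Gamma_less_1_eq[OF q that] q
    by (simp add: h_def P_def powr_def flip: exp_add)
  have Dh: "(h has_real_derivative h' y) (at y)" if "0 < y" for y
    unfolding h_def h'_def
    using that by (auto intro!: derivative_eq_intros DP simp: field_simps)
  have log_deriv: "deriv g y / g y = h' y" if "0 < y" for y
  proof -
    have "((\<lambda>y. exp (h y)) has_real_derivative exp (h y) * h' y) (at y)"
      by (rule DERIV_fun_exp[OF Dh[OF that]])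
    then have "(g has_real_derivative exp (h y) * h' y) (at y)"
      by (rule has_field_derivative_transform_within_open[of _ _ _ ?S]) (use that g in auto)
    then show ?thesis using g[OF that] by (simp add: DERIV_imp_deriv)
  qed
  have "(h' has_real_derivative e + P 2 x) (at x)"
    unfolding h'_def
    using x by (auto intro!: derivative_eq_intros DP simp: numeral_2_eq_2)
  then have "((\<lambda>x. deriv g x / g x) has_real_derivative e + P 2 x) (at x)"
    by (rule has_field_derivative_transform_within_open[of _ _ _ ?S]) (use x log_deriv in auto)
  then show ?thesis unfolding P_def by (rule DERIV_imp_deriv)
qed

lemma deriv_q_digamma_lt_1:
  assumes "0 < q" "q < 1" "0 < x"
  shows "deriv (q_digamma q) x = powr_series q (\<lambda>j. (real j * ln q) ^ 2 * lnqp_coeff q j) x"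
  using deriv_log_deriv_q_Gamma[OF assms, of "q_Gamma q" 0] assms
  by (simp add: q_Gamma_def q_digamma_def[abs_def])

lemma deriv_q_digamma_gt_1:
  assumes "1 < q" "0 < x"
  shows "deriv (q_digamma q) x = ln q + deriv (q_digamma (1 / q)) x"
proof -
  have p: "0 < 1 / q" "1 / q < 1" using assms by auto
  have "deriv (q_digamma q) x =
      ln q + powr_series (1 / q) (\<lambda>j. (real j * ln (1 / q)) ^ 2 * lnqp_coeff (1 / q) j) x"
    unfolding q_digamma_def[abs_def]
    by (rule deriv_log_deriv_q_Gamma[OF p assms(2)])
      (use assms in \<open>simp add: q_Gamma_def powr_def mult.commute\<close>)
  then show ?thesis using deriv_q_digamma_lt_1[OF p assms(2)] by simp
qed

section \<open>Nonnegativity of the coefficients and conclusion\<close>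

text \<open>
  For \<open>j = 0\<close> the truncated index \<open>j - 1\<close> and \<open>0 / 0 = 0\<close> make the coefficient vanish.
\<close>

definition Phi_coeff :: "real \<Rightarrow> nat \<Rightarrow> real" where
  "Phi_coeff q j = - ln q * (real j / (1 - q ^ j)) - - ln q * (real (j - 1) / (1 - q ^ (j - 1)))
     - (if j = 1 then 1 else 0)"

text \<open>Dividing the series by \<open>- ln q\<close> gives the coefficients \<open>b j\<close>;
  the factor 1 - r takes their backward differences, and - r affects only index 1.\<close>

lemma Phi_coeff_sums:
  assumes q: "0 < q" "q < 1" and r: "norm (r :: real) < 1"
  shows "(\<lambda>j. Phi_coeff q j * r ^ j) sums
    ((r - 1) / ln q * (\<Sum>j. (real j * ln q) ^ 2 * lnqp_coeff q j * r ^ j) - r)"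
proof -
  let ?A = "\<Sum>j. (real j * ln q) ^ 2 * lnqp_coeff q j * r ^ j"
  define b where "b j = - ln q * (real j / (1 - q ^ j))" for j
  have "(\<lambda>j. (real j * ln q) ^ 2 * lnqp_coeff q j * r ^ j) sums ?A"
    using disc_summable_power_mult[OF disc_summable_lnqp_coeff[OF q]] r
    unfolding disc_summable_def by blast
  then have "(\<lambda>j. - (1 / ln q) * ((real j * ln q) ^ 2 * lnqp_coeff q j * r ^ j)) sums (- (1 / ln q) * ?A)"
    by (rule sums_mult)
  moreover have "- (1 / ln q) * ((real j * ln q) ^ 2 * lnqp_coeff q j * r ^ j) = b j * r ^ j" for j
    using q by (cases "j = 0") (auto simp: b_def lnqp_coeff_def power2_eq_square)
  ultimately have b: "(\<lambda>j. b j * r ^ j) sums (- (1 / ln q) * ?A)" by simp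
  have "(\<lambda>j. b (Suc j - 1) * r ^ Suc j) sums (r * (- (1 / ln q) * ?A))"
    using sums_mult[OF b, of r] by (simp add: mult_ac)
  \<comment> \<open>The new term at index 0 is \<open>b (0 - 1) = b 0 = 0\<close>.\<close>
  then have "(\<lambda>j. b (j - 1) * r ^ j) sums (r * (- (1 / ln q) * ?A))"
    by (subst (asm) sums_Suc_iff) (simp add: b_def)
  from sums_diff[OF sums_diff[OF b this] sums_single[of 1 "\<lambda>j. r ^ j"]]
  have "(\<lambda>j. b j * r ^ j - b (j - 1) * r ^ j - (if j = 1 then r ^ j else 0)) sums
      (- (1 / ln q) * ?A - r * (- (1 / ln q) * ?A) - r)" by simp
  moreover have "b j * r ^ j - b (j - 1) * r ^ j - (if j = 1 then r ^ j else 0)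
      = Phi_coeff q j * r ^ j" for j
    by (simp add: Phi_coeff_def b_def left_diff_distrib)
  moreover have "- (1 / ln q) * ?A - r * (- (1 / ln q) * ?A) - r = (r - 1) / ln q * ?A - r"
    by (simp add: left_diff_distrib diff_divide_distrib)
  ultimately show ?thesis by simp
qed

text \<open>This is the monotonicity of j / (1 - q^j) from m to m + 1, cleared of
  denominators.\<close>

lemma Suc_mult_power_le:
  fixes q :: real
  assumes "0 \<le> q" "q \<le> 1"
  shows "real (Suc m) * q ^ m \<le> 1 + real m * q ^ Suc m"
proof (induction m)
  case (Suc m)
  \<comment> \<open>Added to \<open>q\<close> times the induction hypothesis, this gives exactly the
    next case.\<close>
  have "0 \<le> (1 - q) * (1 - q ^ Suc m)"
    using assms by (intro mult_nonneg_nonneg) (auto simp: power_le_one mult_le_one)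
  moreover have "q * (real (Suc m) * q ^ m) \<le> q * (1 + real m * q ^ Suc m)"
    using assms Suc by (intro mult_left_mono)
  ultimately show ?case by (simp add: algebra_simps)
qed simp

lemma Phi_coeff_nonneg:
  assumes q: "0 < q" "q < 1"
  shows "0 \<le> Phi_coeff q j"
proof -
  consider "j = 0" | "j = 1" | m where "j = Suc m" "0 < m"
    by (metis One_nat_def not0_implies_Suc zero_less_Suc)
  then show ?thesis
  proof cases
    case 2
    \<comment> \<open>Here the coefficient is - ln q / (1 - q) - 1.\<close>
    have "1 - q \<le> - ln q" using ln_le_minus_one[of q] q by simp
    then show ?thesis using 2 q by (simp add: Phi_coeff_def divide_simps)
  next
    case 3
    have lt: "q ^ m < 1" "q ^ Suc m < 1"
      using q 3 by (auto intro: power_Suc_less_one simp: power_less_one_iff simp del: power_Suc)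
    have "real m * (1 - q ^ Suc m) \<le> real (Suc m) * (1 - q ^ m)"
      using Suc_mult_power_le[of q m] q by (simp add: algebra_simps)
    then have "real m / (1 - q ^ m) \<le> real (Suc m) / (1 - q ^ Suc m)"
      using lt by (simp add: pos_divide_le_eq pos_le_divide_eq del: of_nat_Suc power_Suc)
    then have "- ln q * (real m / (1 - q ^ m)) \<le> - ln q * (real (Suc m) / (1 - q ^ Suc m))"
      using q by (intro mult_left_mono) auto
    then show ?thesis using 3 by (simp add: Phi_coeff_def del: of_nat_Suc power_Suc)
  qed (simp add: Phi_coeff_def)
qed

lemma Phi_fun_eq:
  assumes "0 < q" "q < 1" "0 < x"
  shows "Phi_fun q x = powr_series q (Phi_coeff q) x"
  using sums_unique[OF Phi_coeff_sums[OF assms(1,2), of "q powr x"]] powr_lt_1[OF assms]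
  by (simp add: Phi_fun_def deriv_q_digamma_lt_1[OF assms] powr_series_def)

text \<open>With p = 1/q the prefactors agree. The extra \<open>ln q\<close> in the derivative of
  \<open>q_digamma\<close> contributes 1 - p^x, which turns the final - 1 into - p^x.\<close>

lemma phi_fun_eq_Phi_fun:
  assumes "1 < q" "0 < x"
  shows "phi_fun q x = Phi_fun (1 / q) x"
proof -
  have "(1 / q) powr x = 1 / q powr x" using assms by (simp add: powr_divide)
  moreover have "ln (1 / q) = - ln q" "0 < ln q" "0 < q powr x" using assms by (auto simp: ln_div)
  ultimately show ?thesis
    using assms
    by (simp add: phi_fun_def Phi_fun_def deriv_q_digamma_gt_1 field_simps)
qed

theorem proposition1p6:
  shows "(\<forall>q::real. 0 < q \<and> q < 1 \<longrightarrow>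
            (\<forall>n::nat. completely_monotonic_on {0<..}
               (\<lambda>x. (-1) ^ n * (deriv ^^ n) (Phi_fun q) x))) \<and>
         (\<forall>q::real. q > 1 \<longrightarrow> completely_monotonic_on {0<..} (phi_fun q))"
proof (intro conjI allI impI)
  have summ: "disc_summable (Phi_coeff q)" if "0 < q" "q < 1" for q
    unfolding disc_summable_def using Phi_coeff_sums[OF that] sums_summable by blast
  fix q :: real
  {
    fix n assume "0 < q \<and> q < 1"
    then have q: "0 < q" "q < 1" by auto
    show "completely_monotonic_on {0<..} (\<lambda>x. (-1) ^ n * (deriv ^^ n) (Phi_fun q) x)"
      by (rule completely_monotonic_powr_series[OF q summ[OF q] Phi_coeff_nonneg[OF q] Phi_fun_eq[OF q]])
  next
    assume q: "1 < q"
    then have p: "0 < 1 / q" "1 / q < 1" by auto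
    have "completely_monotonic_on {0<..} (\<lambda>x. (-1) ^ 0 * (deriv ^^ 0) (phi_fun q) x)"
      by (rule completely_monotonic_powr_series[OF p summ[OF p] Phi_coeff_nonneg[OF p]])
        (simp add: phi_fun_eq_Phi_fun[OF q] Phi_fun_eq[OF p])
    then show "completely_monotonic_on {0<..} (phi_fun q)" by simp
  }
qed

end
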